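(* (a) The monoidal preorder $\sqsubseteq$ of any idempotent residuated chain $\mathbf A$ is laced and compatible with $\langle A,\le\rangle$. (b) For any chain $\mathbf C=\langle C,\wedge,\vee\rangle$ and any laced preorder $\sqsubseteq$ on $C$ that is compatible with $\mathbf C$, with $\sqsubseteq$-greatest element $\mathrm e$, the algebra $\langle C,\wedge,\vee,\cdot,\mathrm e\rangle$ is an idempotent totally ordered monoid, where $$x\cdot y=\begin{cases}x&\text{if }x\sqsubseteq y,\\ y&\text{otherwise.}\end{cases}$$ Moreover, if $\mathbf C$ is finite, then $\cdot$ has (uniquely determined) residuals $\backslash$ and $/$, and $\langle C,\wedge,\vee,\cdot,\backslash,/,\mathrm e\rangle$ is an idempotent residuated chain.
   Context: A residuated lattice is an algebra $\mathbf A=\langle A,\wedge,\vee,\cdot,\backslash,/,\mathrm e\rangle$ such that $\langle A,\wedge,\vee\rangle$ is a lattice, $\langle A,\cdot,\mathrm e\rangle$ is a monoid, and for all $a,b,c\in A$: $b\le a\backslash c\iff a\cdot b\le c\iff a\le c/b$. It is idempotent if $aa=a$ for all $a$, and a residuated chain if its lattice order is total. An idempotent totally ordered monoid is a chain with an idempotent monoid operation that is order-preserving in both arguments. The monoidal preorder of an idempotent residuated lattice is: $x\sqsubseteq y$ iff $xy=x$. For a preorder $\sqsubseteq$ on a set, write $x\,{\sqsubseteq\sqsupseteq}\,y$ if $x\sqsubseteq y$ and $y\sqsubseteq x$, and $x\parallel y$ if neither $x\sqsubseteq y$ nor $y\sqsubseteq x$. A preorder $\sqsubseteq$ on a set $A$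 is laced if: 1. it has a unique greatest element, denoted $\mathrm e$; 2. for each $a\in A$, either every other element $b\neq a$ is comparable with $a$ and is not $\sqsubseteq$-equivalent to $a$ (i.e. not $a\,{\sqsubseteq\sqsupseteq}\,b$), in which case put $a^\sharp:=a$; or there is a unique element $a^\sharp\ne a$ such that $a\,{\sqsubseteq\sqsupseteq}\,a^\sharp$ or $a\parallel a^\sharp$; 3. for all $a\in A$ and $x\in A\setminus\{a,a^\sharp\}$: $a\sqsubseteq x\iff a^\sharp\sqsubseteq x$, and $x\sqsubseteq a\iff x\sqsubseteq a^\sharp$. A laced preorder $\sqsubseteq$ on $C$ (with greatest element $\mathrm e$) is compatible with a chain $\langle C,\le\rangle$ if: 1. any least element of $\langle C,\le\rangle$ is also the unique least element of $\sqsubseteq$; 2. for all $x,y\in C$ with $\mathrm e\le x,y$: $x\le y\iff y\sqsubseteq x$; 3. for all $x,y\in C$ with $x,y\le\mathrm e$: $x\le y\iff x\sqsubseteq y$; 4. for each $x\in C$ with $x\neq x^\sharp$: $\mathrm e\le x\iff x^\sharp\le\mathrm e$. *)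

theory Defs
  imports Main
begin

text \<open>
  The carrier of every algebra is a whole type, and all operations are explicit locale parameters.
  The order is a parameter alongside meet and join, as in the library locale \<open>lattice\<close>.
\<close>

locale lattice_chain = lattice meet le less join + linorder le less
  for meet :: "'a \<Rightarrow> 'a \<Rightarrow> 'a" and le less :: "'a \<Rightarrow> 'a \<Rightarrow> bool" and join :: "'a \<Rightarrow> 'a \<Rightarrow> 'a"

text \<open>In \<open>residuals le mult ldiv rdiv\<close>, \<open>ldiv a c\<close> is a under c, and \<open>rdiv c b\<close> is c over b.\<close>

definition residuals ::
  "('a \<Rightarrow> 'a \<Rightarrow> bool) \<Rightarrow> ('a \<Rightarrow> 'a \<Rightarrow> 'a) \<Rightarrow> ('a \<Rightarrow> 'a \<Rightarrow> 'a) \<Rightarrow> ('a \<Rightarrow> 'a \<Rightarrow> 'a) \<Rightarrow> bool"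
  where "residuals le mult ldiv rdiv \<longleftrightarrow>
    (\<forall>a b c. (le b (ldiv a c) \<longleftrightarrow> le (mult a b) c) \<and> (le (mult a b) c \<longleftrightarrow> le a (rdiv c b)))"

locale residuated_lattice = lattice meet le less join + monoid mult e
  for meet :: "'a \<Rightarrow> 'a \<Rightarrow> 'a" and le less :: "'a \<Rightarrow> 'a \<Rightarrow> bool" and join :: "'a \<Rightarrow> 'a \<Rightarrow> 'a"
    and mult :: "'a \<Rightarrow> 'a \<Rightarrow> 'a" and e :: 'a +
  fixes ldiv rdiv :: "'a \<Rightarrow> 'a \<Rightarrow> 'a"
  assumes residuals: "residuals le mult ldiv rdiv"

locale idempotent_residuated_chain =
  residuated_lattice meet le less join mult e ldiv rdiv + lattice_chain meet le less join
  for meet :: "'a \<Rightarrow> 'a \<Rightarrow> 'a" and le less :: "'a \<Rightarrow> 'a \<Rightarrow> bool" and join :: "'a \<Rightarrow> 'a \<Rightarrow> 'a"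
    and mult :: "'a \<Rightarrow> 'a \<Rightarrow> 'a" and e :: 'a and ldiv rdiv :: "'a \<Rightarrow> 'a \<Rightarrow> 'a" +
  assumes mult_idem: "mult a a = a"

locale idempotent_totally_ordered_monoid = lattice_chain meet le less join + monoid mult e
  for meet :: "'a \<Rightarrow> 'a \<Rightarrow> 'a" and le less :: "'a \<Rightarrow> 'a \<Rightarrow> bool" and join :: "'a \<Rightarrow> 'a \<Rightarrow> 'a"
    and mult :: "'a \<Rightarrow> 'a \<Rightarrow> 'a" and e :: 'a +
  assumes mult_idem: "mult a a = a"
    and mult_left_mono: "le a b \<Longrightarrow> le (mult c a) (mult c b)"
    and mult_right_mono: "le a b \<Longrightarrow> le (mult a c) (mult b c)"

definition monoidal_preorder :: "('a \<Rightarrow> 'a \<Rightarrow> 'a) \<Rightarrow> 'a \<Rightarrow> 'a \<Rightarrow> bool"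
  where "monoidal_preorder mult x y \<longleftrightarrow> mult x y = x"

definition preorder_equiv :: "('a \<Rightarrow> 'a \<Rightarrow> bool) \<Rightarrow> 'a \<Rightarrow> 'a \<Rightarrow> bool"
  where "preorder_equiv r x y \<longleftrightarrow> r x y \<and> r y x"

definition incomparable :: "('a \<Rightarrow> 'a \<Rightarrow> bool) \<Rightarrow> 'a \<Rightarrow> 'a \<Rightarrow> bool"
  where "incomparable r x y \<longleftrightarrow> \<not> r x y \<and> \<not> r y x"

definition unpaired :: "('a \<Rightarrow> 'a \<Rightarrow> bool) \<Rightarrow> 'a \<Rightarrow> bool"
  where "unpaired r a \<longleftrightarrow> (\<forall>b. b \<noteq> a \<longrightarrow> \<not> incomparable r a b \<and> \<not> preorder_equiv r a b)"

definition paired :: "('a \<Rightarrow> 'a \<Rightarrow> bool) \<Rightarrow> 'a \<Rightarrow> 'a \<Rightarrow> bool"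
  where "paired r a b \<longleftrightarrow> b \<noteq> a \<and> (preorder_equiv r a b \<or> incomparable r a b)"

text \<open>\<open>sharp r a\<close> is meaningful only if \<open>a\<close> is unpaired or has exactly one partner.\<close>

definition sharp :: "('a \<Rightarrow> 'a \<Rightarrow> bool) \<Rightarrow> 'a \<Rightarrow> 'a"
  where "sharp r a = (if unpaired r a then a else (THE b. paired r a b))"

text \<open>The element \<open>e\<close> is determined by \<open>r\<close>, as its unique greatest element.\<close>

locale laced_preorder = partial_preordering r
  for r :: "'a \<Rightarrow> 'a \<Rightarrow> bool" +
  fixes e :: 'a
  assumes greatest: "r x e"
    and greatest_unique: "(\<And>x. r x y) \<Longrightarrow> y = e"
    and unpaired_or_paired: "unpaired r a \<or> (\<exists>!b. paired r a b)"
    and sharp_below_iff: "x \<notin> {a, sharp r a} \<Longrightarrow> r a x \<longleftrightarrow> r (sharp r a) x"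
    and sharp_above_iff: "x \<notin> {a, sharp r a} \<Longrightarrow> r x a \<longleftrightarrow> r x (sharp r a)"

definition compatible :: "('a \<Rightarrow> 'a \<Rightarrow> bool) \<Rightarrow> ('a \<Rightarrow> 'a \<Rightarrow> bool) \<Rightarrow> 'a \<Rightarrow> bool"
  where "compatible le r e \<longleftrightarrow>
    (\<forall>b. (\<forall>x. le b x) \<longrightarrow> (\<forall>x. r b x) \<and> (\<forall>c. (\<forall>x. r c x) \<longrightarrow> c = b)) \<and>
    (\<forall>x y. le e x \<and> le e y \<longrightarrow> (le x y \<longleftrightarrow> r y x)) \<and>
    (\<forall>x y. le x e \<and> le y e \<longrightarrow> (le x y \<longleftrightarrow> r x y)) \<and>
    (\<forall>x. x \<noteq> sharp r x \<longrightarrow> (le e x \<longleftrightarrow> le (sharp r x) e))"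

definition laced_mult :: "('a \<Rightarrow> 'a \<Rightarrow> bool) \<Rightarrow> 'a \<Rightarrow> 'a \<Rightarrow> 'a"
  where "laced_mult r x y = (if r x y then x else y)"

end

theory Submission
  imports Defs
begin

text \<open>
  Both parts rest on the fact that an idempotent totally ordered monoid is conservative:
  \<open>x y \<in> {x, y}\<close>. In a conservative monoid, two distinct elements are equivalent or incomparable
  in the monoidal preorder exactly if they do not commute. They then lie strictly on opposite sides
  of \<open>e\<close>, so two elements that fail to commute with the same \<open>a\<close> commute with each other, and
  associativity forces them to be equal; this uniqueness of partners makes the preorder laced.
  Conversely, associativity of the multiplication of a laced preorder comes down to excluding
  \<open>r x z\<close> with \<open>\<not> r x y\<close> and \<open>\<not> r y z\<close>: either \<open>y\<close> is the partner of \<open>x\<close>, so \<open>x\<close> and \<open>y\<close> lie below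
  the same third elements, or \<open>r y x\<close>, so transitivity applies. Monotonicity needs only
  transitivity and compatibility on the two cones of \<open>e\<close>. In the finite case the least element
  is absorbing, so the sets that define the residuals are nonempty.
\<close>

section \<open>Partners and the sharp operation\<close>

lemma unpaired_iff: "unpaired r a \<longleftrightarrow> (\<forall>b. \<not> paired r a b)"
  by (auto simp: unpaired_def paired_def)

lemma sharp_unpaired: "unpaired r a \<Longrightarrow> sharp r a = a"
  by (simp add: sharp_def)

lemma sharp_eq:
  assumes "paired r a b" "\<And>c. paired r a c \<Longrightarrow> c = b"
  shows "sharp r a = b"
proof -
  have "\<not> unpaired r a" using assms(1) by (auto simp: unpaired_iff)
  moreover have "(THE c. paired r a c) = b" using assms by (rule the_equality)
  ultimately show ?thesis by (simp add: sharp_def)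
qed

lemma compatibleD:
  assumes "compatible le r e"
  shows "(\<And>x. le b x) \<Longrightarrow> r b x"
    and "(\<And>x. le b x) \<Longrightarrow> (\<And>x. r c x) \<Longrightarrow> c = b"
    and "le e x \<Longrightarrow> le e y \<Longrightarrow> le x y \<longleftrightarrow> r y x"
    and "le x e \<Longrightarrow> le y e \<Longrightarrow> le x y \<longleftrightarrow> r x y"
  using assms unfolding compatible_def by iprover+

section \<open>Conservative monoids\<close>

locale conservative_monoid = monoid mult e
  for mult :: "'a \<Rightarrow> 'a \<Rightarrow> 'a" and e :: 'a +
  assumes conservative: "mult x y = x \<or> mult x y = y"
begin

text \<open>Distinct equivalent elements multiply as left projections, incomparable ones as right
  projections; otherwise both products are the same factor.\<close>

lemma paired_iff: "paired (monoidal_preorder mult) a b \<longleftrightarrow> mult a b \<noteq> mult b a"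
  using conservative[of a b] conservative[of b a]
  by (auto simp: paired_def preorder_equiv_def incomparable_def monoidal_preorder_def)

lemma noncommuting_unique:
  assumes "mult a b \<noteq> mult b a" "mult a c \<noteq> mult c a" "mult b c = mult c b"
  shows "b = c"
proof (rule ccontr)
  \<comment> \<open>The common value of \<open>mult b c\<close> and \<open>mult c b\<close> is one
    of the two factors; by symmetry it may be taken to be \<open>c\<close>.\<close>
  have *: False if bc: "mult b c = c" "mult c b = c" "b \<noteq> c"
    and ab: "mult a b \<noteq> mult b a" and ac: "mult a c \<noteq> mult c a" for b c
  proof -
    \<comment> \<open>Each of the two noncommuting pairs multiplies by left or by right projection;
      every combination contradicts associativity.\<close>
    consider "mult a b = a" "mult b a = b" "mult a c = c" "mult c a = a"
      | "mult a b = a" "mult b a = b" "mult a c = a" "mult c a = c"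
      | "mult a b = b" "mult b a = a" "mult a c = a" "mult c a = c"
      | "mult a b = b" "mult b a = a" "mult a c = c" "mult c a = a"
      using ab ac conservative[of a b] conservative[of b a] conservative[of a c] conservative[of c a]
      by metis
    then show False
    proof cases
      case 1
      then show False using assoc[of c b a] bc ac by simp
    next
      case 2
      then show False using assoc[of b a c] bc by simp
    next
      case 3
      then show False using assoc[of a b c] bc ac by simp
    next
      case 4
      then show False using assoc[of c a b] bc by simp
    qed
  qed
  assume "b \<noteq> c"
  then show False
    using *[of b c] *[of c b] assms conservative[of b c] by auto
qed

end

section \<open>The monoid of a laced preorder\<close>

lemma (in laced_preorder) paired_sharp: "\<not> unpaired r a \<Longrightarrow> paired r a (sharp r a)"
  using unpaired_or_paired[of a] by (metis sharp_eq)

lemma (in laced_preorder) comparable: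
  "b \<noteq> a \<Longrightarrow> b \<noteq> sharp r a \<Longrightarrow> r a b \<or> r b a"
  using unpaired_or_paired[of a] paired_sharp[of a]
  by (metis incomparable_def paired_def unpaired_iff)

lemma (in laced_preorder) monoid_laced_mult: "monoid (laced_mult r) e"
proof
  fix x y z
  \<comment> \<open>In this case the left bracketing gives \<open>z\<close>, while the right one
    would give \<open>x\<close> under \<open>r x z\<close>. The other cases need at most
    transitivity.\<close>
  have "\<not> r x z" if "\<not> r x y" "\<not> r y z" "x \<noteq> z"
  proof
    assume "r x z"
    have "y \<noteq> x" "y \<noteq> z" using that refl by auto
    show False
    proof (cases "y = sharp r x")
      case True
      then show False using sharp_below_iff[of z x] \<open>y \<noteq> z\<close> that \<open>r x z\<close> by auto
    next
      case False
      then have "r y x" using comparable[of y x] \<open>y \<noteq> x\<close> that by auto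
      then show False using trans \<open>r x z\<close> that by blast
    qed
  qed
  then show "laced_mult r (laced_mult r x y) z = laced_mult r x (laced_mult r y z)"
    using trans[of x y z] by (auto simp: laced_mult_def)
next
  fix x
  show "laced_mult r x e = x" by (simp add: laced_mult_def greatest)
  have "x = e" if "r e x"
    using greatest_unique trans[OF greatest that] by blast
  then show "laced_mult r e x = x" by (auto simp: laced_mult_def)
qed

section \<open>Products on either side of the unit\<close>

context idempotent_totally_ordered_monoid
begin

text \<open>Multiplying by an element above \<open>e\<close> never decreases, and idempotence bounds
  the product by the larger factor.\<close>

lemma mult_above:
  assumes "le e x" "le e y"
  shows "mult x y = (if le x y then y else x)"
proof -
  have "le y (mult x y)" "le x (mult x y)"
    using mult_right_mono[of e x y] mult_left_mono[of e y x] assms by simp_all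
  moreover have "le x y \<Longrightarrow> le (mult x y) y" "le y x \<Longrightarrow> le (mult x y) x"
    using mult_right_mono[of x y y] mult_left_mono[of y x x] by (simp_all add: mult_idem)
  ultimately show ?thesis using linear[of x y] order.antisym by auto
qed

lemma mult_below:
  assumes "le x e" "le y e"
  shows "mult x y = (if le x y then x else y)"
proof -
  have "le (mult x y) y" "le (mult x y) x"
    using mult_right_mono[of x e y] mult_left_mono[of y e x] assms by simp_all
  moreover have "le x y \<Longrightarrow> le x (mult x y)" "le y x \<Longrightarrow> le y (mult x y)"
    using mult_left_mono[of x y x] mult_right_mono[of y x y] by (simp_all add: mult_idem)
  ultimately show ?thesis using linear[of x y] order.antisym by auto
qed

text \<open>Either product lies between \<open>x\<close> and \<open>y\<close> and is unchanged when
  its left factor is repeated on the left or its right factor on the right. If it is below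
  \<open>e\<close>, \<open>mult_below\<close> makes it \<open>x\<close>; if above,
  \<open>mult_above\<close> makes it \<open>y\<close>.\<close>

lemma mult_across:
  assumes "le x e" "le e y"
  shows "mult x y = x \<or> mult x y = y" "mult y x = x \<or> mult y x = y"
proof -
  have xz: "mult x (mult x y) = mult x y" and zy: "mult (mult x y) y = mult x y"
    and yz: "mult y (mult y x) = mult y x" and zx: "mult (mult y x) x = mult y x"
    by (simp_all add: assoc mult_idem flip: assoc[of x x] assoc[of y y])
  have b: "le x (mult x y)" "le (mult x y) y" "le x (mult y x)" "le (mult y x) y"
    using mult_left_mono[of e y x] mult_right_mono[of x e y] mult_right_mono[of e y x]
      mult_left_mono[of x e y] assms by simp_all
  show "mult x y = x \<or> mult x y = y"
    using linear[of "mult x y" e] mult_below[of x "mult x y"] mult_above[of "mult x y" y] b xz zy assms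
    by auto
  show "mult y x = x \<or> mult y x = y"
    using linear[of "mult y x" e] mult_below[of "mult y x" x] mult_above[of y "mult y x"] b yz zx assms
    by (auto split: if_splits)
qed

sublocale conservative_monoid mult e
proof
  fix x y
  show "mult x y = x \<or> mult x y = y"
    using linear[of x e] linear[of y e] mult_above[of x y] mult_below[of x y]
      mult_across[of x y] mult_across[of y x] by argo
qed

text \<open>Elements on the same side of \<open>e\<close> commute, their product being a join or a
  meet.\<close>

lemma noncommuting_opposite:
  assumes "mult a b \<noteq> mult b a"
  shows "le e a \<longleftrightarrow> le b e" "le e a \<longleftrightarrow> \<not> le e b"
proof -
  have "\<not> (le e a \<and> le e b)"
    using assms mult_above[of a b] mult_above[of b a] linear[of a b] order.antisym[of a b] by (auto split: if_splits)
  moreover have "\<not> (le a e \<and> le b e)"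
    using assms mult_below[of a b] mult_below[of b a] linear[of a b] order.antisym[of a b] by (auto split: if_splits)
  ultimately show "le e a \<longleftrightarrow> le b e" "le e a \<longleftrightarrow> \<not> le e b"
    using linear[of a e] linear[of b e] by blast+
qed

lemma noncommuting_partner_unique:
  assumes "mult a b \<noteq> mult b a" "mult a c \<noteq> mult c a"
  shows "b = c"
proof (rule noncommuting_unique[OF assms])
  show "mult b c = mult c b"
    using noncommuting_opposite(2)[of a b] noncommuting_opposite(2)[of a c]
      noncommuting_opposite(2)[of b c] assms by blast
qed

lemma sharp_noncommuting:
  assumes "mult a b \<noteq> mult b a"
  shows "sharp (monoidal_preorder mult) a = b"
  using assms by (intro sharp_eq) (auto simp: paired_iff intro: noncommuting_partner_unique[OF _ assms])

lemma sharp_central: "(\<And>b. mult a b = mult b a) \<Longrightarrow> sharp (monoidal_preorder mult) a = a"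
  by (simp add: sharp_unpaired unpaired_iff paired_iff)

lemma noncommuting_sharp:
  "sharp (monoidal_preorder mult) a \<noteq> a \<Longrightarrow>
    mult a (sharp (monoidal_preorder mult) a) \<noteq> mult (sharp (monoidal_preorder mult) a) a"
  using sharp_central[of a] sharp_noncommuting[of a] by force

lemma laced_monoidal_preorder: "laced_preorder (monoidal_preorder mult) e"
proof
  fix a b c x y
  let ?r = "monoidal_preorder mult"
  show "?r a a" by (simp add: monoidal_preorder_def mult_idem)
  show "?r a b \<Longrightarrow> ?r b c \<Longrightarrow> ?r a c"
    unfolding monoidal_preorder_def by (metis assoc)
  show "?r x e" by (simp add: monoidal_preorder_def)
  show "y = e" if "\<And>x. ?r x y"
    using that[of e] by (simp add: monoidal_preorder_def)
  show "unpaired ?r a \<or> (\<exists>!b. paired ?r a b)"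
    unfolding unpaired_iff paired_iff using noncommuting_partner_unique by blast
  assume x: "x \<notin> {a, sharp ?r a}"
  then have ax: "mult a x = mult x a"
    using sharp_noncommuting[of a x] by auto
  have "(?r a x \<longleftrightarrow> ?r (sharp ?r a) x) \<and> (?r x a \<longleftrightarrow> ?r x (sharp ?r a))"
  proof (cases "sharp ?r a = a")
    case False
    define b where "b = sharp ?r a"
    have ab: "mult a b \<noteq> mult b a" using noncommuting_sharp[OF False] by (simp add: b_def)
    have "x \<noteq> a" "x \<noteq> b" using x by (auto simp: b_def)
    then have bx: "mult b x = mult x b"
      using noncommuting_partner_unique[of b a x] ab by metis
    \<comment> \<open>Stated for any noncommuting pair, so that it applies to the partners in both
      orders.\<close>
    have *: "mult b x = b"
      if nc: "mult a b \<noteq> mult b a" and "mult a x = a" "mult b x = mult x b" "x \<noteq> b" for a b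
    proof (rule ccontr)
      assume "mult b x \<noteq> b"
      then have bx: "mult b x = x" "mult x b = x" using conservative[of b x] that by auto
      consider "mult b a = b" | "mult a b = b" "mult b a = a"
        using conservative[of a b] conservative[of b a] nc by metis
      then show False
      proof cases
        case 1
        then have "mult b x = b" using assoc[of b a x] that by simp
        then show False using \<open>mult b x \<noteq> b\<close> by simp
      next
        case 2
        then have "b = a" using assoc[of a x b] that bx by simp
        then show False using nc by simp
      qed
    qed
    have "mult a x = a \<longleftrightarrow> mult b x = b"
      using *[OF ab _ bx \<open>x \<noteq> b\<close>] *[OF ab[symmetric] _ ax \<open>x \<noteq> a\<close>] by blast
    \<comment> \<open>For distinct commuting elements exactly one of the two relations holds, so
      agreement of the partners below \<open>x\<close> yields agreement above
      \<open>x\<close>.\<close>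
    moreover have "mult a x = a \<longleftrightarrow> mult x a \<noteq> x" "mult b x = b \<longleftrightarrow> mult x b \<noteq> x"
      using conservative[of a x] conservative[of b x] ax bx \<open>x \<noteq> a\<close> \<open>x \<noteq> b\<close> by metis+
    ultimately show ?thesis by (auto simp: monoidal_preorder_def b_def)
  qed simp
  then show "?r a x \<longleftrightarrow> ?r (sharp ?r a) x" "?r x a \<longleftrightarrow> ?r x (sharp ?r a)"
    by blast+
qed

text \<open>Absorption by a least element is assumed because order preservation alone does not give
  it: if the product is the join, a least element is the unit. Residuation will supply it.\<close>

lemma compatible_monoidal_preorder:
  assumes "\<And>b x. (\<And>y. le b y) \<Longrightarrow> mult b x = b \<and> mult x b = b"
  shows "compatible le (monoidal_preorder mult) e"
  unfolding compatible_def
proof (intro conjI allI impI)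
  fix b x c
  assume "\<forall>x. le b x"
  then have bot: "mult b x = b" "mult x b = b" for x using assms[of b] by blast+
  show "monoidal_preorder mult b x" by (simp add: bot monoidal_preorder_def)
  show "c = b" if "\<forall>x. monoidal_preorder mult c x"
    using that bot(2)[of c] by (metis monoidal_preorder_def)
next
  fix x y
  assume "le e x \<and> le e y"
  then show "le x y \<longleftrightarrow> monoidal_preorder mult y x"
    using mult_above[of y x] linear[of x y] order.antisym[of x y]
    by (auto simp: monoidal_preorder_def split: if_splits)
next
  fix x y
  assume "le x e \<and> le y e"
  then show "le x y \<longleftrightarrow> monoidal_preorder mult x y"
    using mult_below[of x y] linear[of x y] order.antisym[of x y]
    by (auto simp: monoidal_preorder_def split: if_splits)
next
  fix x
  assume "x \<noteq> sharp (monoidal_preorder mult) x"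
  then show "le e x \<longleftrightarrow> le (sharp (monoidal_preorder mult) x) e"
    by (metis noncommuting_opposite(1)[OF noncommuting_sharp])
qed

text \<open>Translations are monotone and fix the least element, so on a finite chain each has a
  right adjoint, sending \<open>c\<close> to the greatest element mapped below
  \<open>c\<close>.\<close>

lemma residuals_finite:
  assumes "finite (UNIV :: 'a set)"
    and bot: "\<And>b x. (\<And>y. le b y) \<Longrightarrow> mult b x = b \<and> mult x b = b"
  obtains ldiv rdiv where "residuals le mult ldiv rdiv"
proof -
  have fin: "finite A" for A :: "'a set" by (rule finite_subset[OF subset_UNIV assms(1)])
  define b where "b = Min (UNIV :: 'a set)"
  have b: "le b y" for y unfolding b_def by (rule Min_le[OF fin UNIV_I])
  have adj: "\<exists>g. \<forall>x c. le x (g c) \<longleftrightarrow> le (f x) c"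
    if mono: "\<And>x y. le x y \<Longrightarrow> le (f x) (f y)" and "f b = b" for f
  proof -
    have "le x (Max {x. le (f x) c}) \<longleftrightarrow> le (f x) c" for x c
    proof
      have "b \<in> {x. le (f x) c}" by (simp only: mem_Collect_eq \<open>f b = b\<close> b)
      then have "{x. le (f x) c} \<noteq> {}" by blast
      then have "Max {x. le (f x) c} \<in> {x. le (f x) c}" by (rule Max_in[OF fin])
      then show "le (f x) c" if "le x (Max {x. le (f x) c})"
        using mono[OF that] order_trans by blast
      show "le (f x) c \<Longrightarrow> le x (Max {x. le (f x) c})" by (simp add: Max_ge[OF fin])
    qed
    then show ?thesis by (intro exI[of _ "\<lambda>c. Max {x. le (f x) c}"]) blast
  qed
  have "\<forall>a. \<exists>g. \<forall>x c. le x (g c) \<longleftrightarrow> le (mult a x) c"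
    by (intro allI adj mult_left_mono bot[OF b, THEN conjunct2])
  moreover have "\<forall>a. \<exists>g. \<forall>x c. le x (g c) \<longleftrightarrow> le (mult x a) c"
    by (intro allI adj mult_right_mono bot[OF b, THEN conjunct1])
  ultimately obtain ldiv rdiv where
    "\<forall>a x c. le x (ldiv a c) \<longleftrightarrow> le (mult a x) c" "\<forall>a x c. le x (rdiv a c) \<longleftrightarrow> le (mult x a) c"
    by metis
  \<comment> \<open>The adjoint obtained takes the translating element first, whereas a right
    residual takes it second.\<close>
  then have "residuals le mult ldiv (\<lambda>c a. rdiv a c)" by (simp add: residuals_def)
  then show thesis by (rule that)
qed

end

section \<open>Consequences of residuation\<close>

lemma residualsD:
  assumes "residuals le mult ldiv rdiv"
  shows "le b (ldiv a c) \<longleftrightarrow> le (mult a b) c" "le a (rdiv c b) \<longleftrightarrow> le (mult a b) c"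
  using assms by (simp_all add: residuals_def)

text \<open>An element of a partial order is determined by the elements below it, and the
  residuation law prescribes these for every residual.\<close>

lemma (in order) residuals_unique:
  assumes "residuals less_eq mult ldiv rdiv" "residuals less_eq mult ldiv' rdiv'"
  shows "ldiv' = ldiv" "rdiv' = rdiv"
proof -
  have eqI: "x = y" if "\<And>z. less_eq z x \<longleftrightarrow> less_eq z y" for x y
    using that[of x] that[of y] order.antisym[of x y] by simp
  show "ldiv' = ldiv"
    by (intro ext eqI) (simp add: residualsD(1)[OF assms(1)] residualsD(1)[OF assms(2)])
  show "rdiv' = rdiv"
    by (intro ext eqI) (simp add: residualsD(2)[OF assms(1)] residualsD(2)[OF assms(2)])
qed

context idempotent_residuated_chain
begin

sublocale idempotent_totally_ordered_monoid meet le less join mult e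
proof
  fix a b c
  show "mult a a = a" by (rule mult_idem)
  assume ab: "le a b"
  \<comment> \<open>Residuation turns reflexivity at \<open>mult c b\<close> into
    \<open>le b (ldiv c (mult c b))\<close>, which \<open>a\<close> inherits.\<close>
  show "le (mult c a) (mult c b)"
    using order_trans[OF ab, of "ldiv c (mult c b)"] by (simp add: residualsD(1)[OF residuals])
  show "le (mult a c) (mult b c)"
    using order_trans[OF ab, of "rdiv (mult b c) c"] by (simp add: residualsD(2)[OF residuals])
qed

text \<open>A least element lies below all residuals, in particular those of itself, so its products
  cannot exceed it.\<close>

lemma least_absorbing:
  assumes "\<And>y. le b y"
  shows "mult b x = b \<and> mult x b = b"
  using assms residualsD(1)[OF residuals, of b x b] residualsD(2)[OF residuals, of b b x]
    order.antisym[OF _ assms]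
  by simp

end

section \<open>The laced product on a compatible chain\<close>

lemma idempotent_totally_ordered_monoid_laced_mult:
  fixes less :: "'a \<Rightarrow> 'a \<Rightarrow> bool"
  assumes "lattice_chain meet le less join" "laced_preorder r e" "compatible le r e"
  shows "idempotent_totally_ordered_monoid meet le less join (laced_mult r) e"
proof -
  interpret lattice_chain meet le less join by fact
  interpret r: laced_preorder r e by fact
  interpret monoid "laced_mult r" e by (rule r.monoid_laced_mult)
  have above: "le x y \<longleftrightarrow> r y x" if "le e x" "le e y" for x y
    using compatibleD(3)[OF assms(3)] that by blast
  have below: "le x y \<longleftrightarrow> r x y" if "le x e" "le y e" for x y
    using compatibleD(4)[OF assms(3)] that by blast
  show ?thesis
  proof
    fix a b c
    show "laced_mult r a a = a" by (simp add: laced_mult_def)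
    assume ab: "le a b"
    \<comment> \<open>The facts \<open>up\<close> and \<open>down\<close> treat the mixed outcomes,
      where one product is \<open>c\<close> and the other is not: a value \<open>b\<close> above
      \<open>e\<close> dominates \<open>c\<close>, and a value \<open>a\<close> below
      \<open>e\<close> is dominated by \<open>c\<close>.\<close>
    have up: "le c b" if "le e b" "\<not> r c b \<or> r b c"
      using that linear[of c e] linear[of c b] above[of b c] above[of c b] order_trans[of c e b] by blast
    have down: "le a c" if "le a e" "\<not> r c a \<or> r a c"
      using that linear[of c e] linear[of a c] below[of a c] below[of c a] order_trans[of a e c] by blast
    have "le (laced_mult r c a) (laced_mult r c b) \<and> le (laced_mult r a c) (laced_mult r b c)"
    \<comment> \<open>With \<open>a\<close> and \<open>b\<close> on the same side of
      \<open>e\<close>, transitivity of \<open>r\<close> excludes one mixed outcome; with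
      \<open>e\<close> between them, both can occur.\<close>
    proof (cases "le e a")
      case True
      then have "le e b" "r b a" using ab above order_trans by blast+
      then show ?thesis
        using up ab r.trans[of b a c] r.trans[of c b a] by (auto simp: laced_mult_def)
    next
      case False
      then have "le a e" using linear by blast
      show ?thesis
      proof (cases "le e b")
        case True
        then show ?thesis using up down ab \<open>le a e\<close> by (auto simp: laced_mult_def)
      next
        case False
        then have "le b e" "r a b" using linear below \<open>le a e\<close> ab by blast+
        then show ?thesis
          using down ab \<open>le a e\<close> r.trans[of a b c] r.trans[of c a b] by (auto simp: laced_mult_def)
      qed
    qed
    then show "le (laced_mult r c a) (laced_mult r c b)" "le (laced_mult r a c) (laced_mult r b c)"
      by blast+
  qed
qed

text \<open>By compatibility \<open>b\<close> is the unique \<open>r\<close>-least element, and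
  anything \<open>r\<close>-below it is \<open>r\<close>-least too, hence equal to it.\<close>

lemma least_absorbing_laced_mult:
  assumes "laced_preorder r e" "compatible le r e" "\<And>y. le b y"
  shows "laced_mult r b x = b \<and> laced_mult r x b = b"
proof -
  interpret laced_preorder r e by fact
  have b: "r b x" for x by (rule compatibleD(1)[OF assms(2,3)])
  have "x = b" if "r x b"
    by (rule compatibleD(2)[OF assms(2,3)]) (rule trans[OF that b])
  then show ?thesis by (auto simp: laced_mult_def b)
qed

theorem theorem4p3:
  shows "(\<forall>(meet :: 'a \<Rightarrow> 'a \<Rightarrow> 'a) le less join mult e ldiv rdiv.
      idempotent_residuated_chain meet le less join mult e ldiv rdiv \<longrightarrow>
      laced_preorder (monoidal_preorder mult) e \<and> compatible le (monoidal_preorder mult) e) \<and>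
    (\<forall>(meet :: 'a \<Rightarrow> 'a \<Rightarrow> 'a) le less join r e.
      lattice_chain meet le less join \<and> laced_preorder r e \<and> compatible le r e \<longrightarrow>
      idempotent_totally_ordered_monoid meet le less join (laced_mult r) e \<and>
      (finite (UNIV :: 'a set) \<longrightarrow>
        (\<exists>ldiv rdiv. residuals le (laced_mult r) ldiv rdiv \<and>
          (\<forall>ldiv' rdiv'. residuals le (laced_mult r) ldiv' rdiv' \<longrightarrow> ldiv' = ldiv \<and> rdiv' = rdiv) \<and>
          idempotent_residuated_chain meet le less join (laced_mult r) e ldiv rdiv)))"
proof (intro conjI allI impI)
  fix meet :: "'a \<Rightarrow> 'a \<Rightarrow> 'a" and le less join mult e ldiv rdiv
  assume "idempotent_residuated_chain meet le less join mult e ldiv rdiv"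
  then interpret idempotent_residuated_chain meet le less join mult e ldiv rdiv .
  show "laced_preorder (monoidal_preorder mult) e" by (rule laced_monoidal_preorder)
  show "compatible le (monoidal_preorder mult) e"
    using compatible_monoidal_preorder least_absorbing by blast
next
  fix meet :: "'a \<Rightarrow> 'a \<Rightarrow> 'a" and le less join r e
  assume "lattice_chain meet le less join \<and> laced_preorder r e \<and> compatible le r e"
  then have *: "lattice_chain meet le less join" "laced_preorder r e" "compatible le r e" by blast+
  show "idempotent_totally_ordered_monoid meet le less join (laced_mult r) e"
    using * by (rule idempotent_totally_ordered_monoid_laced_mult)
  then interpret idempotent_totally_ordered_monoid meet le less join "laced_mult r" e .
  assume "finite (UNIV :: 'a set)"
  \<comment> \<open>Here absorption comes from compatibility, not from residuation.\<close>
  then obtain ldiv rdiv where res: "residuals le (laced_mult r) ldiv rdiv"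
    using residuals_finite least_absorbing_laced_mult[OF *(2,3)] by metis
  moreover have "idempotent_residuated_chain meet le less join (laced_mult r) e ldiv rdiv"
    by unfold_locales (use res mult_idem in auto)
  ultimately show "\<exists>ldiv rdiv. residuals le (laced_mult r) ldiv rdiv \<and>
      (\<forall>ldiv' rdiv'. residuals le (laced_mult r) ldiv' rdiv' \<longrightarrow> ldiv' = ldiv \<and> rdiv' = rdiv) \<and>
      idempotent_residuated_chain meet le less join (laced_mult r) e ldiv rdiv"
    using residuals_unique by metis
qed

end
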